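(* Let $a=1+a_2\mathbf{j}+a_3\mathbf{k}$ with $a_2^2+a_3^2=1$, $b=b_1\mathbf{i}+b_2\mathbf{j}+b_3\mathbf{k}\neq0$, $c=c_0+c_1\mathbf{i}+c_2\mathbf{j}+c_3\mathbf{k}$ be split quaternions (all coefficients real) such that $P_{ab}=0$ and $P_{a\mathbf{i},b}=0$ (these imply $b_1\neq0$). Then $ax^2+bx+c=0$ has a solution $x\in SZ$ if and only if $ac=2c$. If it is solvable, then the solutions are as follows. (1) Solutions with $x_0=0$: (1.1) If $a_2=0$, the equation has the solutions $x=x_1\mathbf{i}+x_2\mathbf{j}+\frac{c_1}{a_3b_1}\mathbf{k}$, where $$x_2=\frac{-a_3b_1\pm\sqrt{b_1^2-4\big(\frac{c_1^2}{b_1^2}+c_0-x_1^2-b_1x_1\big)}}{2}$$ and $x_1\in\mathbb{R}$ satisfies $x_1^2+b_1x_1+\frac{b_1^2}{4}-\frac{c_1^2}{b_1^2}-c_0\ge0$. (1.2) If $a_2\neq0$, the equation has the solutions $x=x_1\mathbf{i}+x_2\mathbf{j}+x_3\mathbf{k}$, where $x_3\in\mathbb{R}$ satisfies $$w=x_3^2-\frac{2a_3c_1+a_2b_1^2}{b_1}x_3+\frac{4(a_2^2b_1^2c_0+a_2b_1^2a_3c_1+c_1^2)+b_1^4a_2^2}{4b_1^2}\ge0$$ and $x_1=-\frac{b_1}{2}\pm\frac{\sqrt w}{a_2}$, $x_2=\frac{c_1}{a_2b_1}-\frac{a_3}{a_2}x_3$. (2) Solutions with $x_0\neq0$: (2.1)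 With $a_2x_2+a_3x_3\neq\frac{c_1}{b_1}$ ($x_2,x_3\in\mathbb{R}$): the equation has the solutions $x=T+x_1\mathbf{i}+x_2\mathbf{j}+x_3\mathbf{k}$, where $T$ is a real solution of the equation in $z$ $$z^4+2(a_2x_2+a_3x_3)z^3+\Big[(a_2x_2+a_3x_3)^2+b_1(a_3x_2-a_2x_3)+c_0+\frac{b_1^2}{4}\Big]z^2$$ $$+\big[a_2a_3b_1(x_2^2-x_3^2)+b_1(a_3^2-a_2^2)x_2x_3+c_1(a_2x_3-a_3x_2)\big]z-\frac{[b_1(a_2x_2+a_3x_3)-c_1]^2}{4}=0$$ and $$x_1=\Big(\frac{a_2b_1}{2T}-a_3\Big)x_2+\Big(\frac{a_3b_1}{2T}+a_2\Big)x_3-\frac{c_1+b_1T}{2T}.$$ (2.2) With $a_2x_2+a_3x_3=\frac{c_1}{b_1}$: the equation has the solutions $x=x_0+x_1\mathbf{i}+x_2\mathbf{j}+x_3\mathbf{k}$ for all real $x_0\neq0$, where $$x_1=\frac{1}{b_1}x_0^2+\frac{2c_1}{b_1^2}x_0+\frac{c_1^2}{b_1^3}-\frac{b_1}{4}+\frac{c_0}{b_1},\quad x_2=\frac{a_2c_1}{b_1}-\frac{a_3b_1}{2}-a_3x_1,\quad x_3=\frac{a_3c_1}{b_1}+\frac{a_2b_1}{2}+a_2x_1.$$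
   Context: $\mathbb{H}_s$ is the real algebra of split quaternions $x=x_0+x_1\mathbf{i}+x_2\mathbf{j}+x_3\mathbf{k}$ ($x_i\in\mathbb{R}$), with $\mathbf{i}^2=-1$, $\mathbf{j}^2=\mathbf{k}^2=1$, $\mathbf{i}\mathbf{j}=\mathbf{k}=-\mathbf{j}\mathbf{i}$, $\mathbf{j}\mathbf{k}=-\mathbf{i}=-\mathbf{k}\mathbf{j}$, $\mathbf{k}\mathbf{i}=\mathbf{j}=-\mathbf{i}\mathbf{k}$. Put $I_x=x_0^2+x_1^2-x_2^2-x_3^2$ and $P_{x,y}=P_{xy}=x_0y_0+x_1y_1-x_2y_2-x_3y_3$; $Z(\mathbb{H}_s)=\{x: I_x=0\}$ is the set of zero divisors. In coordinates $P_{ab}=-a_2b_2-a_3b_3$ and $P_{a\mathbf{i},b}=a_2b_3-a_3b_2+b_1$. For the equation $ax^2+bx+c=0$, $SZ=\{x\in\mathbb{H}_s: ax^2+bx+c=0\text{ and }2x_0a+b\in Z(\mathbb{H}_s)\}$, where $x_0$ is the real part of $x$. *)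

theory Defs
  imports "HOL-Analysis.Analysis"
begin

codatatype split_quat =
  SQ (sq0: real) (sq1: real) (sq2: real) (sq3: real)

lemma split_quat_eqI [intro?]:
  "\<lbrakk>sq0 x = sq0 y; sq1 x = sq1 y; sq2 x = sq2 y; sq3 x = sq3 y\<rbrakk> \<Longrightarrow> x = y"
  by (rule split_quat.expand) simp

lemma split_quat_eq_iff:
  "x = y \<longleftrightarrow> sq0 x = sq0 y \<and> sq1 x = sq1 y \<and> sq2 x = sq2 y \<and> sq3 x = sq3 y"
  by (auto intro: split_quat.expand)

instantiation split_quat :: real_algebra_1
begin

primcorec zero_split_quat where
  "sq0 0 = 0" | "sq1 0 = 0" | "sq2 0 = 0" | "sq3 0 = 0"

primcorec one_split_quat where
  "sq0 1 = 1" | "sq1 1 = 0" | "sq2 1 = 0" | "sq3 1 = 0"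

primcorec plus_split_quat where
  "sq0 (x + y) = sq0 x + sq0 y"
| "sq1 (x + y) = sq1 x + sq1 y"
| "sq2 (x + y) = sq2 x + sq2 y"
| "sq3 (x + y) = sq3 x + sq3 y"

primcorec uminus_split_quat where
  "sq0 (- x) = - sq0 x"
| "sq1 (- x) = - sq1 x"
| "sq2 (- x) = - sq2 x"
| "sq3 (- x) = - sq3 x"

primcorec minus_split_quat where
  "sq0 (x - y) = sq0 x - sq0 y"
| "sq1 (x - y) = sq1 x - sq1 y"
| "sq2 (x - y) = sq2 x - sq2 y"
| "sq3 (x - y) = sq3 x - sq3 y"

primcorec scaleR_split_quat where
  "sq0 (scaleR r x) = r * sq0 x"
| "sq1 (scaleR r x) = r * sq1 x"
| "sq2 (scaleR r x) = r * sq2 x"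
| "sq3 (scaleR r x) = r * sq3 x"

text \<open>The product is the bilinear extension of the multiplication table
  recorded in \<open>split_quat_units_mult\<close> below.\<close>

primcorec times_split_quat where
  "sq0 (x * y) = sq0 x * sq0 y - sq1 x * sq1 y + sq2 x * sq2 y + sq3 x * sq3 y"
| "sq1 (x * y) = sq0 x * sq1 y + sq1 x * sq0 y - sq2 x * sq3 y + sq3 x * sq2 y"
| "sq2 (x * y) = sq0 x * sq2 y + sq2 x * sq0 y - sq1 x * sq3 y + sq3 x * sq1 y"
| "sq3 (x * y) = sq0 x * sq3 y + sq3 x * sq0 y + sq1 x * sq2 y - sq2 x * sq1 y"

instance
  by standard (simp_all add: split_quat_eq_iff algebra_simps)

end

definition sq_i :: split_quat where "sq_i = SQ 0 1 0 0"
definition sq_j :: split_quat where "sq_j = SQ 0 0 1 0"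
definition sq_k :: split_quat where "sq_k = SQ 0 0 0 1"

lemma split_quat_units_mult:
  "sq_i * sq_i = - 1" "sq_j * sq_j = 1" "sq_k * sq_k = 1"
  "sq_i * sq_j = sq_k" "sq_j * sq_i = - sq_k"
  "sq_j * sq_k = - sq_i" "sq_k * sq_j = sq_i"
  "sq_k * sq_i = sq_j" "sq_i * sq_k = - sq_j"
  by (simp_all add: split_quat_eq_iff sq_i_def sq_j_def sq_k_def)

lemma SQ_eq:
  "SQ x0 x1 x2 x3 = of_real x0 + x1 *\<^sub>R sq_i + x2 *\<^sub>R sq_j + x3 *\<^sub>R sq_k"
  by (simp add: split_quat_eq_iff sq_i_def sq_j_def sq_k_def of_real_def)

definition sq_I :: "split_quat \<Rightarrow> real" where
  "sq_I x = (sq0 x)\<^sup>2 + (sq1 x)\<^sup>2 - (sq2 x)\<^sup>2 - (sq3 x)\<^sup>2"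

definition sq_P :: "split_quat \<Rightarrow> split_quat \<Rightarrow> real" where
  "sq_P x y = sq0 x * sq0 y + sq1 x * sq1 y - sq2 x * sq2 y - sq3 x * sq3 y"

text \<open>With this convention \<open>0\<close> counts as a zero divisor.\<close>

definition sq_Z :: "split_quat set" where
  "sq_Z = {x. sq_I x = 0}"

lemma sq_Z_iff_zero_divisor: "x \<in> sq_Z \<longleftrightarrow> (\<exists>y. y \<noteq> 0 \<and> x * y = 0)"
proof -
  let ?x' = "SQ (sq0 x) (- sq1 x) (- sq2 x) (- sq3 x)"
  have r: "x * ?x' = sq_I x *\<^sub>R 1" and l: "?x' * x = sq_I x *\<^sub>R 1"
    by (simp_all add: split_quat_eq_iff sq_I_def power2_eq_square)
  show ?thesis
  proof
    assume "x \<in> sq_Z"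
    then have I: "sq_I x = 0" by (simp add: sq_Z_def)
    show "\<exists>y. y \<noteq> 0 \<and> x * y = 0"
    proof (cases "x = 0")
      case True
      then show ?thesis by (intro exI[of _ 1]) simp
    next
      case False
      then have "?x' \<noteq> 0" by (simp add: split_quat_eq_iff)
      with r I show ?thesis by auto
    qed
  next
    assume "\<exists>y. y \<noteq> 0 \<and> x * y = 0"
    then obtain y where y: "y \<noteq> 0" "x * y = 0" by blast
    have "sq_I x *\<^sub>R y = ?x' * x * y" by (simp add: l)
    also have "\<dots> = 0" by (simp only: mult.assoc y(2) mult_zero_right)
    finally show "x \<in> sq_Z" using y(1) by (simp add: sq_Z_def)
  qed
qed

definition SZ :: "split_quat \<Rightarrow> split_quat \<Rightarrow> split_quat \<Rightarrow> split_quat set" where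
  "SZ a b c = {x. a * x\<^sup>2 + b * x + c = 0 \<and> (2 * sq0 x) *\<^sub>R a + b \<in> sq_Z}"

end

theory Submission
  imports Defs
begin

text \<open>The two orthogonality conditions say exactly that \<open>b = b\<^sub>1 a i\<close>, so the equation reads
  \<open>a (x\<^sup>2 + b\<^sub>1 i x) + c = 0\<close>. Two things follow. First, \<open>2 x\<^sub>0 a + b = a (2 x\<^sub>0 + b\<^sub>1 i)\<close> is always a
  zero divisor, because \<open>a\<close> is one and \<open>I\<close> is multiplicative: every solution lies in \<open>SZ\<close>.
  Second, \<open>a\<^sup>2 = 2 a\<close>, so \<open>a / 2\<close> is an idempotent and the right ideal it generates is
  \<open>{y. a y = 2 y}\<close>. Hence \<open>a c = 2 c\<close> is necessary for solvability; and when it holds, the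
  equation lives in this ideal, which is a plane with coordinates \<open>y\<^sub>0, y\<^sub>1\<close>.

  What remains is a pair of real equations. In the reflected coordinates
  \<open>s = a\<^sub>2 x\<^sub>2 + a\<^sub>3 x\<^sub>3\<close>, \<open>r = a\<^sub>3 x\<^sub>2 - a\<^sub>2 x\<^sub>3\<close> they are
  \<open>(x\<^sub>0 + s)\<^sup>2 + (r - x\<^sub>1) (r + x\<^sub>1 + b\<^sub>1) + c\<^sub>0 = 0\<close> and \<open>x\<^sub>0 (2 (x\<^sub>1 + r) + b\<^sub>1) = b\<^sub>1 s - c\<^sub>1\<close>
  (lemma \<open>mem_SZ_iff_coords\<close>). If \<open>x\<^sub>0 = 0\<close>, the second equation fixes \<open>s\<close> and the first is a
  quadratic in either \<open>x\<^sub>1\<close> or \<open>r\<close>. If \<open>x\<^sub>0 \<noteq> 0\<close>, the second equation gives \<open>x\<^sub>1\<close>, and substituting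
  it into the first yields the quartic; the quartic degenerates to a linear equation for \<open>r\<close>
  when \<open>b\<^sub>1 s = c\<^sub>1\<close>. In that degenerate family \<open>x\<^sub>0 \<noteq> 0\<close> is free, which also provides the
  solution needed for the converse of the solvability criterion.\<close>

section \<open>The ideal generated by the coefficient a\<close>

lemma sq_units_coords [simp]:
  "sq0 sq_i = 0" "sq1 sq_i = 1" "sq2 sq_i = 0" "sq3 sq_i = 0"
  "sq0 sq_j = 0" "sq1 sq_j = 0" "sq2 sq_j = 1" "sq3 sq_j = 0"
  "sq0 sq_k = 0" "sq1 sq_k = 0" "sq2 sq_k = 0" "sq3 sq_k = 1"
  by (simp_all add: sq_i_def sq_j_def sq_k_def)

lemma sq_of_real_coords [simp]:
  "sq0 (of_real t) = t" "sq1 (of_real t) = 0" "sq2 (of_real t) = 0" "sq3 (of_real t) = 0"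
  by (simp_all add: of_real_def)

lemma sq_I_mult: "sq_I (x * y) = sq_I x * sq_I y"
  by (simp add: sq_I_def) algebra

text \<open>Every split quaternion satisfies \<open>x\<^sup>2 = 2 x\<^sub>0 x - I\<^sub>x\<close>; here the real part is \<open>1\<close> and
  \<open>I\<^sub>a = 0\<close>.\<close>

lemma square_eq_double:
  fixes a :: split_quat and a2 a3 :: real
  assumes "a = 1 + a2 *\<^sub>R sq_j + a3 *\<^sub>R sq_k" "a2\<^sup>2 + a3\<^sup>2 = 1"
  shows "a * a = 2 * a"
  using assms(2) unfolding mult_2 by (simp add: assms(1) split_quat_eq_iff power2_eq_square)

text \<open>The ideal \<open>{y. a y = 2 y}\<close> lies in the plane spanned by \<open>a\<close> and \<open>a i\<close>, whose real and
  \<open>i\<close> coordinates are \<open>(1, 0)\<close> and \<open>(0, 1)\<close>; those two coordinates therefore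
  determine an element.\<close>

lemma ideal_eq_0_iff:
  fixes a y :: split_quat and a2 a3 :: real
  assumes a: "a = 1 + a2 *\<^sub>R sq_j + a3 *\<^sub>R sq_k"
    and y: "a * y = 2 * y"
  shows "y = 0 \<longleftrightarrow> sq0 y = 0 \<and> sq1 y = 0"
proof -
  have "sq2 y = a2 * sq0 y + a3 * sq1 y" "sq3 y = a3 * sq0 y - a2 * sq1 y"
    using y by (simp_all add: a mult_2[where 'a = split_quat] split_quat_eq_iff)
  then show ?thesis by (auto simp: split_quat_eq_iff)
qed

text \<open>Orthogonality to \<open>a\<close> and \<open>a i\<close> leaves a two-dimensional space which, \<open>a\<close> and \<open>a i\<close> being
  isotropic and mutually orthogonal, is again their span; the vanishing real part of \<open>b\<close> then
  singles out the multiples of \<open>a i\<close>.\<close>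

lemma orthogonal_imp_multiple_of_ai:
  fixes a b :: split_quat and a2 a3 b1 b2 b3 :: real
  assumes a: "a = 1 + a2 *\<^sub>R sq_j + a3 *\<^sub>R sq_k"
    and norm_a: "a2\<^sup>2 + a3\<^sup>2 = 1"
    and b: "b = b1 *\<^sub>R sq_i + b2 *\<^sub>R sq_j + b3 *\<^sub>R sq_k"
    and Pab: "sq_P a b = 0" and Paib: "sq_P (a * sq_i) b = 0"
  shows "b = b1 *\<^sub>R (a * sq_i)"
proof -
  have "a2 * b2 + a3 * b3 = 0" "b1 = a3 * b2 - a2 * b3"
    using Pab Paib by (simp_all add: a b sq_P_def)
  with norm_a have "b2 = a3 * b1" "b3 = - a2 * b1"
    by algebra+
  then show ?thesis by (simp add: a b split_quat_eq_iff)
qed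

lemma equation_factored:
  fixes a b x :: split_quat and b1 :: real
  assumes "b = b1 *\<^sub>R (a * sq_i)"
  shows "a * x\<^sup>2 + b * x = a * (x\<^sup>2 + b1 *\<^sub>R (sq_i * x))"
  by (simp add: assms distrib_left mult.assoc)

lemma mem_SZ_iff_solution:
  fixes a b c x :: split_quat and b1 :: real
  assumes "a \<in> sq_Z" and b: "b = b1 *\<^sub>R (a * sq_i)"
  shows "x \<in> SZ a b c \<longleftrightarrow> a * x\<^sup>2 + b * x + c = 0"
proof -
  have "(2 * sq0 x) *\<^sub>R a + b = a * (of_real (2 * sq0 x) + b1 *\<^sub>R sq_i)"
    by (simp add: b distrib_left of_real_def)
  then have "(2 * sq0 x) *\<^sub>R a + b \<in> sq_Z"
    using assms(1) by (simp add: sq_Z_def sq_I_mult)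
  then show ?thesis by (simp add: SZ_def)
qed

lemma solvable_imp_ac_eq_2c:
  fixes a b c x :: split_quat and b1 :: real
  assumes aa: "a * a = 2 * a" and b: "b = b1 *\<^sub>R (a * sq_i)" and x: "x \<in> SZ a b c"
  shows "a * c = 2 * c"
proof -
  define u where "u = x\<^sup>2 + b1 *\<^sub>R (sq_i * x)"
  have "a * u + c = 0"
    using x unfolding u_def equation_factored[OF b, symmetric] by (simp add: SZ_def)
  then have "c = - (a * u)" by (simp add: eq_neg_iff_add_eq_0 add.commute)
  then have "a * c = - ((a * a) * u)" by (simp add: mult.assoc)
  also have "\<dots> = 2 * - (a * u)" by (simp add: aa mult.assoc)
  finally show ?thesis using \<open>c = - (a * u)\<close> by simp
qed

section \<open>Reduction to two real equations\<close>

lemma mem_SZ_iff_coords: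
  fixes a b c x :: split_quat and a2 a3 b1 :: real
  assumes a: "a = 1 + a2 *\<^sub>R sq_j + a3 *\<^sub>R sq_k"
    and norm_a: "a2\<^sup>2 + a3\<^sup>2 = 1"
    and b: "b = b1 *\<^sub>R (a * sq_i)"
    and ac: "a * c = 2 * c"
  defines "s \<equiv> a2 * sq2 x + a3 * sq3 x" and "r \<equiv> a3 * sq2 x - a2 * sq3 x"
  shows "x \<in> SZ a b c \<longleftrightarrow>
      (sq0 x + s)\<^sup>2 + (r - sq1 x) * (r + sq1 x + b1) + sq0 c = 0
    \<and> sq0 x * (2 * (sq1 x + r) + b1) = b1 * s - sq1 c"
proof -
  define y where "y = a * (x\<^sup>2 + b1 *\<^sub>R (sq_i * x)) + c"
  have "a \<in> sq_Z"
    using norm_a by (simp add: a sq_Z_def sq_I_def)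
  then have "x \<in> SZ a b c \<longleftrightarrow> y = 0"
    by (simp add: mem_SZ_iff_solution[OF _ b] equation_factored[OF b] y_def)
  also have "a * y = 2 * y"
    unfolding y_def distrib_left ac
    by (simp only: mult.assoc[symmetric] square_eq_double[OF a norm_a])
  then have "y = 0 \<longleftrightarrow> sq0 y = 0 \<and> sq1 y = 0"
    by (rule ideal_eq_0_iff[OF a])
  also have "sq0 y = (sq0 x + s)\<^sup>2 + (r - sq1 x) * (r + sq1 x + b1) + sq0 c"
  proof -
    \<comment> \<open>\<open>(s, r)\<close> is an reflection of \<open>(x\<^sub>2, x\<^sub>3)\<close>.\<close>
    have "s\<^sup>2 + r\<^sup>2 = (sq2 x)\<^sup>2 + (sq3 x)\<^sup>2"
      using norm_a unfolding s_def r_def by algebra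
    moreover have "sq0 y = (sq0 x)\<^sup>2 - (sq1 x)\<^sup>2 + ((sq2 x)\<^sup>2 + (sq3 x)\<^sup>2)
        - b1 * sq1 x + 2 * sq0 x * s + b1 * r + sq0 c"
      by (simp add: y_def a s_def r_def power2_eq_square algebra_simps)
    ultimately show ?thesis by (simp add: power2_eq_square algebra_simps)
  qed
  also have "sq1 y = sq0 x * (2 * (sq1 x + r) + b1) - (b1 * s - sq1 c)"
    by (simp add: y_def a s_def r_def power2_eq_square algebra_simps)
  finally show ?thesis by simp
qed

text \<open>The matrix with rows \<open>(a\<^sub>2, a\<^sub>3)\<close> and \<open>(a\<^sub>3, - a\<^sub>2)\<close> is a reflection, hence its own inverse.\<close>

lemma eq_reflected_coords_iff:
  fixes a2 a3 x2 x3 s r :: real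
  assumes "a2\<^sup>2 + a3\<^sup>2 = 1"
  shows "a2 * x2 + a3 * x3 = s \<and> a3 * x2 - a2 * x3 = r \<longleftrightarrow>
    x2 = a2 * s + a3 * r \<and> x3 = a3 * s - a2 * r"
proof (intro iffI conjI; elim conjE)
  assume "a2 * x2 + a3 * x3 = s" "a3 * x2 - a2 * x3 = r"
  with assms show "x2 = a2 * s + a3 * r" "x3 = a3 * s - a2 * r" by algebra+
next
  assume "x2 = a2 * s + a3 * r" "x3 = a3 * s - a2 * r"
  with assms show "a2 * x2 + a3 * x3 = s" "a3 * x2 - a2 * x3 = r" by algebra+
qed

section \<open>Solving the real equations\<close>

lemma square_eq_iff_pm_sqrt:
  fixes u v :: real
  shows "u\<^sup>2 = v \<longleftrightarrow> v \<ge> 0 \<and> (u = sqrt v \<or> u = - sqrt v)"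
proof
  assume "u\<^sup>2 = v"
  then show "v \<ge> 0 \<and> (u = sqrt v \<or> u = - sqrt v)" by (auto simp: abs_if)
qed (auto simp: real_sqrt_pow2)

text \<open>For \<open>a\<^sub>2 = 0\<close> the coordinate \<open>x\<^sub>3 = s / a\<^sub>3\<close> is fixed and \<open>r = a\<^sub>3 x\<^sub>2\<close>, so the first real
  equation is a quadratic in \<open>x\<^sub>2\<close>.\<close>

lemma real_part_0_a2_eq_0_iff:
  fixes a3 b1 c0 c1 x1 x2 x3 :: real
  assumes a3: "a3\<^sup>2 = 1" and b1: "b1 \<noteq> 0"
  defines "D \<equiv> b1\<^sup>2 - 4 * (c1\<^sup>2 / b1\<^sup>2 + c0 - x1\<^sup>2 - b1 * x1)"
  shows "(a3 * x3)\<^sup>2 + (a3 * x2 - x1) * (a3 * x2 + x1 + b1) + c0 = 0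
        \<and> b1 * (a3 * x3) = c1 \<longleftrightarrow>
      x1\<^sup>2 + b1 * x1 + b1\<^sup>2 / 4 - c1\<^sup>2 / b1\<^sup>2 - c0 \<ge> 0
    \<and> (x2 = (- (a3 * b1) + sqrt D) / 2 \<or> x2 = (- (a3 * b1) - sqrt D) / 2)
    \<and> x3 = c1 / (a3 * b1)"
proof -
  have "a3 \<noteq> 0" using a3 by auto
  then have x3: "b1 * (a3 * x3) = c1 \<longleftrightarrow> x3 = c1 / (a3 * b1)"
    using b1 by (auto simp: field_simps)
  have "(a3 * x3)\<^sup>2 + (a3 * x2 - x1) * (a3 * x2 + x1 + b1) + c0 = 0 \<longleftrightarrow> (2 * x2 + a3 * b1)\<^sup>2 = D"
    if "b1 * (a3 * x3) = c1"
  proof -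
    have "a3 * x3 = c1 / b1" using that b1 by (auto simp: field_simps)
    moreover have "(2 * x2 + a3 * b1)\<^sup>2 - D =
        4 * ((c1 / b1)\<^sup>2 + (a3 * x2 - x1) * (a3 * x2 + x1 + b1) + c0)"
      using a3 unfolding D_def power_divide by algebra
    ultimately show ?thesis by auto
  qed
  moreover have "D \<ge> 0 \<longleftrightarrow> x1\<^sup>2 + b1 * x1 + b1\<^sup>2 / 4 - c1\<^sup>2 / b1\<^sup>2 - c0 \<ge> 0"
    unfolding D_def by (auto simp: algebra_simps)
  ultimately show ?thesis
    unfolding x3[symmetric] square_eq_iff_pm_sqrt by (auto simp: field_simps)
qed

text \<open>For \<open>a\<^sub>2 \<noteq> 0\<close> the coordinate \<open>x\<^sub>3\<close> is kept as parameter. Completing the square in \<open>x\<^sub>1\<close> turns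
  the first real equation into \<open>(x\<^sub>1 + b\<^sub>1/2)\<^sup>2 = (r + b\<^sub>1/2)\<^sup>2 + s\<^sup>2 + c\<^sub>0\<close>, and \<open>w\<close> is \<open>a\<^sub>2\<^sup>2\<close> times
  its right-hand side.\<close>

lemma real_part_0_a2_neq_0_iff:
  fixes a2 a3 b1 c0 c1 x1 x2 x3 :: real
  assumes norm_a: "a2\<^sup>2 + a3\<^sup>2 = 1" and b1: "b1 \<noteq> 0" and a2: "a2 \<noteq> 0"
  defines "w \<equiv> x3\<^sup>2 - (2 * a3 * c1 + a2 * b1\<^sup>2) / b1 * x3
      + (4 * (a2\<^sup>2 * b1\<^sup>2 * c0 + a2 * b1\<^sup>2 * a3 * c1 + c1\<^sup>2) + b1 ^ 4 * a2\<^sup>2) / (4 * b1\<^sup>2)"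
    and "s \<equiv> a2 * x2 + a3 * x3" and "r \<equiv> a3 * x2 - a2 * x3"
  shows "s\<^sup>2 + (r - x1) * (r + x1 + b1) + c0 = 0 \<and> b1 * s = c1 \<longleftrightarrow>
    w \<ge> 0 \<and> (x1 = - (b1 / 2) + sqrt w / a2 \<or> x1 = - (b1 / 2) - sqrt w / a2)
    \<and> x2 = c1 / (a2 * b1) - a3 / a2 * x3"
proof -
  have x2: "b1 * s = c1 \<longleftrightarrow> x2 = c1 / (a2 * b1) - a3 / a2 * x3"
    using b1 a2 by (auto simp: s_def field_simps)
  have "s\<^sup>2 + (r - x1) * (r + x1 + b1) + c0 = 0 \<longleftrightarrow> (a2 * (x1 + b1 / 2))\<^sup>2 = w"
    if c1: "b1 * s = c1"
  proof -
    have "(2 * a3 * c1 + a2 * b1\<^sup>2) / b1 = 2 * a3 * s + a2 * b1"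
      using b1 by (simp add: c1[symmetric] field_simps power2_eq_square)
    moreover have "(4 * (a2\<^sup>2 * b1\<^sup>2 * c0 + a2 * b1\<^sup>2 * a3 * c1 + c1\<^sup>2) + b1 ^ 4 * a2\<^sup>2) / (4 * b1\<^sup>2)
        = a2\<^sup>2 * c0 + a2 * a3 * b1 * s + s\<^sup>2 + b1\<^sup>2 * a2\<^sup>2 / 4"
      using b1 by (simp add: c1[symmetric] field_simps power2_eq_square power4_eq_xxxx)
    ultimately have w: "w = x3\<^sup>2 - (2 * a3 * s + a2 * b1) * x3
        + (a2\<^sup>2 * c0 + a2 * a3 * b1 * s + s\<^sup>2 + b1\<^sup>2 * a2\<^sup>2 / 4)"
      by (simp add: w_def)
    have x3: "x3 = a3 * s - a2 * r"
      using eq_reflected_coords_iff[OF norm_a, of x2 x3 s r] by (simp add: s_def r_def)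
    have "w - (a2 * (x1 + b1 / 2))\<^sup>2 = a2\<^sup>2 * (s\<^sup>2 + (r - x1) * (r + x1 + b1) + c0)
        + (1 - (a2\<^sup>2 + a3\<^sup>2)) * s\<^sup>2"
      unfolding w x3 by (simp add: power2_eq_square algebra_simps)
    then show ?thesis using a2 norm_a by auto
  qed
  moreover have "a2 * (x1 + b1 / 2) = t \<longleftrightarrow> x1 = - (b1 / 2) + t / a2" for t
    using a2 by (auto simp: field_simps)
  ultimately show ?thesis
    unfolding x2[symmetric] square_eq_iff_pm_sqrt by auto
qed

text \<open>With \<open>q = (b\<^sub>1 s - c\<^sub>1) / (2 x\<^sub>0)\<close> the second real equation is \<open>x\<^sub>1 = q - r - b\<^sub>1/2\<close>, and then
  \<open>(r - x\<^sub>1) (r + x\<^sub>1 + b\<^sub>1) = (2 r + b\<^sub>1/2 - q) (q + b\<^sub>1/2)\<close> is free of \<open>x\<^sub>1\<close>. Multiplying the first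
  equation by \<open>x\<^sub>0\<^sup>2\<close> clears the denominators.\<close>

lemma real_part_neq_0_iff:
  fixes b1 c0 c1 T x1 s r :: real
  assumes T: "T \<noteq> 0"
  shows "(T + s)\<^sup>2 + (r - x1) * (r + x1 + b1) + c0 = 0 \<and> T * (2 * (x1 + r) + b1) = b1 * s - c1 \<longleftrightarrow>
      T ^ 4 + 2 * s * T ^ 3 + (s\<^sup>2 + b1 * r + c0 + b1\<^sup>2 / 4) * T\<^sup>2
        + r * (b1 * s - c1) * T - (b1 * s - c1)\<^sup>2 / 4 = 0
    \<and> x1 = (b1 * s - c1) / (2 * T) - r - b1 / 2"
proof -
  have x1: "T * (2 * (x1 + r) + b1) = b1 * s - c1 \<longleftrightarrow> x1 = (b1 * s - c1) / (2 * T) - r - b1 / 2"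
    using T by (auto simp: field_simps)
  have "T ^ 4 + 2 * s * T ^ 3 + (s\<^sup>2 + b1 * r + c0 + b1\<^sup>2 / 4) * T\<^sup>2
        + r * (b1 * s - c1) * T - (b1 * s - c1)\<^sup>2 / 4 =
      T\<^sup>2 * ((T + s)\<^sup>2 + (r - x1) * (r + x1 + b1) + c0)"
    if "T * (2 * (x1 + r) + b1) = b1 * s - c1"
    unfolding that[symmetric]
    by (simp add: field_simps power2_eq_square power3_eq_cube power4_eq_xxxx)
  then have "T ^ 4 + 2 * s * T ^ 3 + (s\<^sup>2 + b1 * r + c0 + b1\<^sup>2 / 4) * T\<^sup>2
        + r * (b1 * s - c1) * T - (b1 * s - c1)\<^sup>2 / 4 = 0 \<longleftrightarrow>
      (T + s)\<^sup>2 + (r - x1) * (r + x1 + b1) + c0 = 0"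
    if "T * (2 * (x1 + r) + b1) = b1 * s - c1"
    using T that by simp
  then show ?thesis unfolding x1[symmetric] by blast
qed

text \<open>The degenerate case \<open>b\<^sub>1 s = c\<^sub>1\<close>: the quartic loses its last two terms, and after division by
  \<open>x\<^sub>0\<^sup>2\<close> it is linear in \<open>r = - x\<^sub>1 - b\<^sub>1/2\<close>.\<close>

lemma real_part_neq_0_degenerate_iff:
  fixes b1 c0 c1 T x1 s r :: real
  assumes T: "T \<noteq> 0" and b1: "b1 \<noteq> 0" and s: "s = c1 / b1"
  shows "(T + s)\<^sup>2 + (r - x1) * (r + x1 + b1) + c0 = 0 \<and> T * (2 * (x1 + r) + b1) = b1 * s - c1 \<longleftrightarrow>
      x1 = 1 / b1 * T\<^sup>2 + 2 * c1 / b1\<^sup>2 * T + c1\<^sup>2 / b1 ^ 3 - b1 / 4 + c0 / b1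
    \<and> r = - x1 - b1 / 2"
proof -
  have r: "T * (2 * (x1 + r) + b1) = b1 * s - c1 \<longleftrightarrow> r = - x1 - b1 / 2"
    using T b1 by (auto simp: s)
  have "1 / b1 * T\<^sup>2 + 2 * c1 / b1\<^sup>2 * T + c1\<^sup>2 / b1 ^ 3 - b1 / 4 + c0 / b1
      = ((T + s)\<^sup>2 + c0) / b1 - b1 / 4"
    using b1 by (simp add: s field_simps power2_eq_square power3_eq_cube)
  moreover have "(T + s)\<^sup>2 + (r - x1) * (r + x1 + b1) + c0 = 0 \<longleftrightarrow>
      x1 = ((T + s)\<^sup>2 + c0) / b1 - b1 / 4"
    if "r = - x1 - b1 / 2"
  proof -
    have "(T + s)\<^sup>2 + (r - x1) * (r + x1 + b1) + c0 = (T + s)\<^sup>2 + c0 - b1 * (x1 + b1 / 4)"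
      unfolding that by (simp add: algebra_simps)
    moreover have "Y - b1 * (x1 + b1 / 4) = 0 \<longleftrightarrow> x1 = Y / b1 - b1 / 4" for Y
      using b1 by (auto simp: field_simps)
    ultimately show ?thesis by (simp only:)
  qed
  ultimately show ?thesis unfolding r by metis
qed

section \<open>The solution set\<close>

theorem theorem3p3:
  fixes a b c :: split_quat
    and a2 a3 b1 b2 b3 c0 c1 c2 c3 :: real
  assumes a: "a = 1 + a2 *\<^sub>R sq_j + a3 *\<^sub>R sq_k"
    and norm_a: "a2\<^sup>2 + a3\<^sup>2 = 1"
    and b: "b = b1 *\<^sub>R sq_i + b2 *\<^sub>R sq_j + b3 *\<^sub>R sq_k"
    and b_nz: "b \<noteq> 0"
    and c: "c = of_real c0 + c1 *\<^sub>R sq_i + c2 *\<^sub>R sq_j + c3 *\<^sub>R sq_k"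
    and Pab: "sq_P a b = 0"
    and Paib: "sq_P (a * sq_i) b = 0"
  shows "b1 \<noteq> 0
    \<and> ((\<exists>x. x \<in> SZ a b c) \<longleftrightarrow> a * c = 2 * c)
    \<and> ((\<exists>x. x \<in> SZ a b c) \<longrightarrow>
        (a2 = 0 \<longrightarrow>
          {x \<in> SZ a b c. sq0 x = 0} =
          {x. \<exists>x1 x2 :: real.
              x1\<^sup>2 + b1 * x1 + b1\<^sup>2 / 4 - c1\<^sup>2 / b1\<^sup>2 - c0 \<ge> 0
            \<and> (x2 = (- (a3 * b1) + sqrt (b1\<^sup>2 - 4 * (c1\<^sup>2 / b1\<^sup>2 + c0 - x1\<^sup>2 - b1 * x1))) / 2
               \<or> x2 = (- (a3 * b1) - sqrt (b1\<^sup>2 - 4 * (c1\<^sup>2 / b1\<^sup>2 + c0 - x1\<^sup>2 - b1 * x1))) / 2)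
            \<and> x = x1 *\<^sub>R sq_i + x2 *\<^sub>R sq_j + (c1 / (a3 * b1)) *\<^sub>R sq_k})
      \<and> (a2 \<noteq> 0 \<longrightarrow>
          {x \<in> SZ a b c. sq0 x = 0} =
          {x. \<exists>x1 x2 x3 w :: real.
              w = x3\<^sup>2 - (2 * a3 * c1 + a2 * b1\<^sup>2) / b1 * x3
                  + (4 * (a2\<^sup>2 * b1\<^sup>2 * c0 + a2 * b1\<^sup>2 * a3 * c1 + c1\<^sup>2) + b1 ^ 4 * a2\<^sup>2)
                    / (4 * b1\<^sup>2)
            \<and> w \<ge> 0
            \<and> (x1 = - (b1 / 2) + sqrt w / a2 \<or> x1 = - (b1 / 2) - sqrt w / a2)
            \<and> x2 = c1 / (a2 * b1) - a3 / a2 * x3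
            \<and> x = x1 *\<^sub>R sq_i + x2 *\<^sub>R sq_j + x3 *\<^sub>R sq_k})
      \<and> {x \<in> SZ a b c. sq0 x \<noteq> 0 \<and> a2 * sq2 x + a3 * sq3 x \<noteq> c1 / b1} =
          {x. \<exists>T x1 x2 x3 :: real.
              a2 * x2 + a3 * x3 \<noteq> c1 / b1
            \<and> T ^ 4 + 2 * (a2 * x2 + a3 * x3) * T ^ 3
              + ((a2 * x2 + a3 * x3)\<^sup>2 + b1 * (a3 * x2 - a2 * x3) + c0 + b1\<^sup>2 / 4) * T\<^sup>2
              + (a2 * a3 * b1 * (x2\<^sup>2 - x3\<^sup>2) + b1 * (a3\<^sup>2 - a2\<^sup>2) * x2 * x3
                 + c1 * (a2 * x3 - a3 * x2)) * T
              - (b1 * (a2 * x2 + a3 * x3) - c1)\<^sup>2 / 4 = 0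
            \<and> x1 = (a2 * b1 / (2 * T) - a3) * x2 + (a3 * b1 / (2 * T) + a2) * x3
                   - (c1 + b1 * T) / (2 * T)
            \<and> x = of_real T + x1 *\<^sub>R sq_i + x2 *\<^sub>R sq_j + x3 *\<^sub>R sq_k}
      \<and> {x \<in> SZ a b c. sq0 x \<noteq> 0 \<and> a2 * sq2 x + a3 * sq3 x = c1 / b1} =
          {x. \<exists>x0 x1 x2 x3 :: real.
              x0 \<noteq> 0
            \<and> x1 = 1 / b1 * x0\<^sup>2 + 2 * c1 / b1\<^sup>2 * x0 + c1\<^sup>2 / b1 ^ 3 - b1 / 4 + c0 / b1
            \<and> x2 = a2 * c1 / b1 - a3 * b1 / 2 - a3 * x1
            \<and> x3 = a3 * c1 / b1 + a2 * b1 / 2 + a2 * x1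
            \<and> x = of_real x0 + x1 *\<^sub>R sq_i + x2 *\<^sub>R sq_j + x3 *\<^sub>R sq_k})"
proof -
  have b': "b = b1 *\<^sub>R (a * sq_i)"
    by (rule orthogonal_imp_multiple_of_ai[OF a norm_a b Pab Paib])
  have b1: "b1 \<noteq> 0"
    using b_nz b' by auto
  have necessary: "a * c = 2 * c" if "x \<in> SZ a b c" for x
    using solvable_imp_ac_eq_2c[OF square_eq_double[OF a norm_a] b' that] .
  have c_coords: "sq0 c = c0" "sq1 c = c1"
    by (simp_all add: c)
  note mem_iff = mem_SZ_iff_coords[OF a norm_a b', of c, unfolded c_coords]

  have sufficient: "\<exists>x. x \<in> SZ a b c" if ac: "a * c = 2 * c"
  proof -
    \<comment> \<open>The member with \<open>x\<^sub>0 = 1\<close> of the family \<open>b\<^sub>1 s = c\<^sub>1\<close>, obtained by undoing the reflection.\<close>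
    define s x1 where "s = c1 / b1"
      and "x1 = 1 / b1 * 1\<^sup>2 + 2 * c1 / b1\<^sup>2 * 1 + c1\<^sup>2 / b1 ^ 3 - b1 / 4 + c0 / b1"
    define r where "r = - x1 - b1 / 2"
    define x2 x3 where "x2 = a2 * s + a3 * r" and "x3 = a3 * s - a2 * r"
    have sr: "a2 * x2 + a3 * x3 = s" "a3 * x2 - a2 * x3 = r"
      using eq_reflected_coords_iff[OF norm_a, of x2 x3 s r] by (simp_all add: x2_def x3_def)
    have "SQ 1 x1 x2 x3 \<in> SZ a b c"
      unfolding mem_iff[OF ac] split_quat.sel sr
      by (rule iffD2[OF real_part_neq_0_degenerate_iff[OF one_neq_zero b1 s_def] conjI[OF x1_def r_def]])
    then show ?thesis by blast
  qed

  have case_0_0: "x \<in> SZ a b c \<and> sq0 x = 0 \<longleftrightarrow>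
        sq0 x = 0 \<and> (sq1 x)\<^sup>2 + b1 * sq1 x + b1\<^sup>2 / 4 - c1\<^sup>2 / b1\<^sup>2 - c0 \<ge> 0
      \<and> (sq2 x = (- (a3 * b1) + sqrt (b1\<^sup>2 - 4 * (c1\<^sup>2 / b1\<^sup>2 + c0 - (sq1 x)\<^sup>2 - b1 * sq1 x))) / 2
       \<or> sq2 x = (- (a3 * b1) - sqrt (b1\<^sup>2 - 4 * (c1\<^sup>2 / b1\<^sup>2 + c0 - (sq1 x)\<^sup>2 - b1 * sq1 x))) / 2)
      \<and> sq3 x = c1 / (a3 * b1)" if "a * c = 2 * c" "a2 = 0" for x
  proof -
    have "a3\<^sup>2 = 1" using norm_a that(2) by simp
    from real_part_0_a2_eq_0_iff[OF this b1, of "sq3 x" "sq2 x" "sq1 x" c0 c1]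
    show ?thesis using that(2) by (auto simp: mem_iff[OF that(1)])
  qed

  have case_0: "x \<in> SZ a b c \<and> sq0 x = 0 \<longleftrightarrow> sq0 x = 0 \<and>
      (let w = (sq3 x)\<^sup>2 - (2 * a3 * c1 + a2 * b1\<^sup>2) / b1 * sq3 x
          + (4 * (a2\<^sup>2 * b1\<^sup>2 * c0 + a2 * b1\<^sup>2 * a3 * c1 + c1\<^sup>2) + b1 ^ 4 * a2\<^sup>2) / (4 * b1\<^sup>2)
       in w \<ge> 0 \<and> (sq1 x = - (b1 / 2) + sqrt w / a2 \<or> sq1 x = - (b1 / 2) - sqrt w / a2)
      \<and> sq2 x = c1 / (a2 * b1) - a3 / a2 * sq3 x)" if "a * c = 2 * c" "a2 \<noteq> 0" for x
    unfolding Let_def real_part_0_a2_neq_0_iff[OF norm_a b1 that(2), symmetric]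
    by (auto simp: mem_iff[OF that(1)])

  have case_generic: "x \<in> SZ a b c \<and> sq0 x \<noteq> 0 \<and> a2 * sq2 x + a3 * sq3 x \<noteq> c1 / b1 \<longleftrightarrow>
        a2 * sq2 x + a3 * sq3 x \<noteq> c1 / b1
      \<and> sq0 x ^ 4 + 2 * (a2 * sq2 x + a3 * sq3 x) * sq0 x ^ 3
        + ((a2 * sq2 x + a3 * sq3 x)\<^sup>2 + b1 * (a3 * sq2 x - a2 * sq3 x) + c0 + b1\<^sup>2 / 4) * (sq0 x)\<^sup>2
        + (a2 * a3 * b1 * ((sq2 x)\<^sup>2 - (sq3 x)\<^sup>2) + b1 * (a3\<^sup>2 - a2\<^sup>2) * sq2 x * sq3 x
           + c1 * (a2 * sq3 x - a3 * sq2 x)) * sq0 x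
        - (b1 * (a2 * sq2 x + a3 * sq3 x) - c1)\<^sup>2 / 4 = 0
      \<and> sq1 x = (a2 * b1 / (2 * sq0 x) - a3) * sq2 x + (a3 * b1 / (2 * sq0 x) + a2) * sq3 x
             - (c1 + b1 * sq0 x) / (2 * sq0 x)" (is "_ \<longleftrightarrow> ?s \<noteq> _ \<and> ?quartic = 0 \<and> _ = ?x1")
    if ac: "a * c = 2 * c" for x
  proof (cases "sq0 x = 0")
    case True
    \<comment> \<open>At \<open>x\<^sub>0 = 0\<close> the quartic reduces to \<open>-(b\<^sub>1 s - c\<^sub>1)\<^sup>2 / 4\<close>, which the first condition
      keeps away from zero.\<close>
    then show ?thesis using b1 by (auto simp: field_simps)
  next
    case False
    let ?r = "a3 * sq2 x - a2 * sq3 x"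
    have lin: "a2 * a3 * b1 * ((sq2 x)\<^sup>2 - (sq3 x)\<^sup>2) + b1 * (a3\<^sup>2 - a2\<^sup>2) * sq2 x * sq3 x
        + c1 * (a2 * sq3 x - a3 * sq2 x) = ?r * (b1 * ?s - c1)"
      by (simp add: power2_eq_square algebra_simps)
    have x1: "?x1 = (b1 * ?s - c1) / (2 * sq0 x) - ?r - b1 / 2"
      using False by (simp add: field_simps)
    show ?thesis
      unfolding lin x1 mem_iff[OF ac] real_part_neq_0_iff[OF False] using False by blast
  qed

  have case_degenerate: "x \<in> SZ a b c \<and> sq0 x \<noteq> 0 \<and> a2 * sq2 x + a3 * sq3 x = c1 / b1 \<longleftrightarrow>
        sq0 x \<noteq> 0
      \<and> sq1 x = 1 / b1 * (sq0 x)\<^sup>2 + 2 * c1 / b1\<^sup>2 * sq0 x + c1\<^sup>2 / b1 ^ 3 - b1 / 4 + c0 / b1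
      \<and> sq2 x = a2 * c1 / b1 - a3 * b1 / 2 - a3 * sq1 x
      \<and> sq3 x = a3 * c1 / b1 + a2 * b1 / 2 + a2 * sq1 x"
    (is "_ \<longleftrightarrow> _ \<and> sq1 x = ?x1 \<and> sq2 x = ?x2 \<and> sq3 x = ?x3") if ac: "a * c = 2 * c" for x
  proof (cases "sq0 x = 0")
    case False
    let ?s = "a2 * sq2 x + a3 * sq3 x" and ?r = "a3 * sq2 x - a2 * sq3 x"
    have "?s = c1 / b1 \<and> ?r = - sq1 x - b1 / 2 \<longleftrightarrow> sq2 x = ?x2 \<and> sq3 x = ?x3"
      unfolding eq_reflected_coords_iff[OF norm_a] by (simp add: algebra_simps)
    moreover have "x \<in> SZ a b c \<longleftrightarrow> sq1 x = ?x1 \<and> ?r = - sq1 x - b1 / 2" if "?s = c1 / b1"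
      unfolding mem_iff[OF ac] using real_part_neq_0_degenerate_iff[OF False b1 that] .
    ultimately show ?thesis using False by blast
  qed simp

  have split_quat_eq_unit_sum_iff:
    "x = of_real x0 + x1 *\<^sub>R sq_i + x2 *\<^sub>R sq_j + x3 *\<^sub>R sq_k \<longleftrightarrow>
      x0 = sq0 x \<and> x1 = sq1 x \<and> x2 = sq2 x \<and> x3 = sq3 x"
    "x = x1 *\<^sub>R sq_i + x2 *\<^sub>R sq_j + x3 *\<^sub>R sq_k \<longleftrightarrow>
      sq0 x = 0 \<and> x1 = sq1 x \<and> x2 = sq2 x \<and> x3 = sq3 x" for x x0 x1 x2 x3
    by (auto simp: split_quat_eq_iff)

  show ?thesis
  proof (cases "a * c = 2 * c")
    case False
    then have "\<nexists>x. x \<in> SZ a b c" using necessary by blast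
    with b1 False show ?thesis by blast
  next
    case True
    show ?thesis
      unfolding set_eq_iff mem_Collect_eq split_quat_eq_unit_sum_iff
        case_generic[OF True] case_degenerate[OF True]
    proof (intro conjI impI allI)
      show "b1 \<noteq> 0" by (rule b1)
      show "(\<exists>x. x \<in> SZ a b c) \<longleftrightarrow> a * c = 2 * c"
        using True sufficient by blast
    qed ((subst case_0_0[OF True], assumption, auto)[1],
        (subst case_0[OF True], assumption, auto simp only: Let_def)[1], auto)
  qed
qed

end
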